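(* Let $d\ge 1$, $\beta>0$, and let $\phi$ be a stable, tempered and lower-regular pair potential on $\mathbb{R}^d$. Let $\mathcal{B}$ be an admissible collection of boundary conditions such that, for every $x>0$ and every $b\in\mathcal{B}$, the limit $p(x)=\lim_{L\to\infty}p(x;\Lambda_L,b)$ exists and is independent of $b\in\mathcal{B}$. Fix $z_0>0$ and $b\in\mathcal{B}$, and suppose that for some $\delta>0$ the function $\Xi(\,\cdot\,;\Lambda_L,b)$ has no zeros in the open disc $B_\delta(z_0)=\{z\in\mathbb{C}:|z-z_0|<\delta\}$ for all sufficiently large $L$; for such $L$ let $p(\,\cdot\,;\Lambda_L,b)$ also denote the holomorphic branch of $|\Lambda_L|^{-1}\log\Xi(\,\cdot\,;\Lambda_L,b)$ on $B_\delta(z_0)$ that is real at $z_0$. Then $p$ restricted to $B_{\delta/2}(z_0)\cap(0,\infty)$ has a holomorphic extension to $B_{\delta/2}(z_0)$, still denoted $p$, and for every $n\ge1$, $$\partial_z^n p(\,\cdot\,;\Lambda_L,b)\to\partial_z^n p\quad\text{uniformly on }B_{\delta/2}(z_0)\text{ as }L\to\infty.$$ Moreover, with $\mu_0=\beta^{-1}\log z_0$, the finite-volume density $\langle N_{\Lambda_L}\rangle/|\Lambda_L|$ and the variance per unit volume $\big(\langle N_{\Lambda_L}^2\rangle-\langle N_{\Lambda_L}\rangle^2\big)/|\Lambda_L|$, taken at $\mu=\mu_0$ with boundary condition $b$, converge as $L\to\infty$ to $\beta^{-1}\partial_\mu p(\mu_0)$ and $\beta^{-2}\partial_\mu^2p(\mu_0)$,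 respectively, where $p(\mu)$ denotes the limiting pressure as a function of $\mu$, i.e. $p$ evaluated at fugacity $e^{\beta\mu}$.
   Context: Pair potential: $\phi$ is a measurable radial function on $\mathbb{R}^d$ with values in $\mathbb{R}\cup\{+\infty\}$, written $\phi(x)=\phi(|x|)$, and $\phi(x_1,\dots,x_N)=\sum_{i<j}\phi(|x_i-x_j|)$. It is: stable if there is $B\ge 0$ with $\phi(x_1,\dots,x_N)\ge -BN$ for every finite configuration; tempered if there are $R_0\ge 0$, $\varepsilon>0$ with $\phi(x)\le |x|^{-(d+\varepsilon)}$ for all $|x|\ge R_0$; lower-regular if there are $R_1\ge 0$ and a decreasing (non-increasing) $\psi:[R_1,\infty)\to[0,\infty)$ with $\phi(x)\ge-\psi(|x|)$ for all $|x|\ge R_1$ and $\int_{R_1}^\infty\psi(r)r^{d-1}\,dr<\infty$. Cubes: $\Lambda_L=[-L,L]^d$, $L\ge1$; $|\Lambda|$ is the volume. Boundary conditions: a boundary condition $b$ is either a configuration of particles (a locally finite set of points of $\mathbb{R}^d$), of which the points in $\Lambda^c$ act on the particles in $\Lambda$, or the periodic boundary condition. For a configuration, $\phi_b(x)=\sum_{y\in b\cap\Lambda^c}\phi(x-y)$ is the energy of a particle at $x\in\Lambda$ due to $b$; if the sum of the positive parts $\phi^+=\max(\phi,0)$ diverges, $\phi_b(x):=+\infty$ and $e^{-\beta\phi_b(x)}:=0$; the convention $0\cdot\infty=0$ is used. For the periodic boundary condition in $\Lambda_L$, $\phi_b=0$ and $\phi(|x_i-x_j|)$ is replaced by $\sum_{k\in(2L\mathbb{Z})^d}\phi(|x_i-x_j+k|)$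 (with value $+\infty$ if the positive parts diverge). Grand canonical partition function, with fugacity $z=e^{\beta\mu}$: $$\Xi(z;\Lambda,b)=\sum_{N=0}^\infty\frac{z^N}{N!}\int_{\Lambda^N}e^{-\beta\phi(x_1,\dots,x_N)}\prod_{i=1}^N e^{-\beta\phi_b(x_i)}\,dx_1\cdots dx_N,$$ with $N=0$ term equal to $1$. For real $x>0$ the finite-volume pressure is $p(x;\Lambda,b)=|\Lambda|^{-1}\log\Xi(x;\Lambda,b)$. For $z>0$, $\langle\cdot\rangle$ denotes expectation in the grand canonical measure in $\Lambda$ with boundary condition $b$; under it the particle number $N_\Lambda$ takes the value $N$ with probability equal to the $N$-th term of the series divided by $\Xi(z;\Lambda,b)$. Admissibility: a collection $\mathcal{B}$ of boundary conditions is admissible if there are constants $c_1,c_2<\infty$ and $L_1<\infty$ such that $$|\Lambda_L|^{-1}\log\Xi(|z|;\Lambda_L,b)\le c_1|z|+c_2\quad\text{for all }z\in\mathbb{C},\ b\in\mathcal{B},\ L\ge L_1.$$ *)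

theory Defs
  imports "HOL-Analysis.Analysis"
begin

text \<open>Euclidean space of dimension $d$ is \<^typ>\<open>real ^ 'd\<close>, with $d$ = \<^term>\<open>CARD('d)\<close>.\<close>

section \<open>Pair potentials\<close>

definition pair_potential :: "(real ^ 'd::finite \<Rightarrow> ereal) \<Rightarrow> bool" where
  "pair_potential \<phi> \<longleftrightarrow>
     \<phi> \<in> borel_measurable borel \<and>
     (\<forall>x y. norm x = norm y \<longrightarrow> \<phi> x = \<phi> y) \<and>
     (\<forall>x. \<phi> x \<noteq> -\<infinity>)"

text \<open>The sum over pairs for an arbitrary two-body interaction \<^term>\<open>v\<close>; \<^term>\<open>v\<close> is the
  potential itself or its periodisation. Particles are labelled by $0,\dots,N-1$.\<close>

definition pair_energy :: "(real ^ 'd::finite \<Rightarrow> ereal) \<Rightarrow> nat \<Rightarrow> (nat \<Rightarrow> real ^ 'd) \<Rightarrow> ereal" where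
  "pair_energy v N x = (\<Sum>j<N. \<Sum>i<j. v (x i - x j))"

text \<open>A configuration is a set of points, so stability only concerns distinct points.\<close>

definition stable_potential :: "(real ^ 'd::finite \<Rightarrow> ereal) \<Rightarrow> bool" where
  "stable_potential \<phi> \<longleftrightarrow>
     (\<exists>B\<ge>0. \<forall>N x. inj_on x {..<N} \<longrightarrow> pair_energy \<phi> N x \<ge> ereal (- B * real N))"

text \<open>At \<^term>\<open>x = 0\<close> the library value of \<^term>\<open>norm x powr (- a)\<close> is 0 rather than infinite; this
  has no effect on the definition, since \<^term>\<open>R0\<close> may always be enlarged.\<close>

definition tempered :: "(real ^ 'd::finite \<Rightarrow> ereal) \<Rightarrow> bool" where
  "tempered \<phi> \<longleftrightarrow>
     (\<exists>R0\<ge>0. \<exists>\<epsilon>>0. \<forall>x. norm x \<ge> R0 \<longrightarrow> \<phi> x \<le> ereal (norm x powr (- (real CARD('d) + \<epsilon>))))"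

definition lower_regular :: "(real ^ 'd::finite \<Rightarrow> ereal) \<Rightarrow> bool" where
  "lower_regular \<phi> \<longleftrightarrow>
     (\<exists>R1\<ge>0. \<exists>\<psi>::real \<Rightarrow> real.
        antimono_on {R1..} \<psi> \<and> (\<forall>r\<ge>R1. \<psi> r \<ge> 0) \<and>
        (\<forall>x. norm x \<ge> R1 \<longrightarrow> \<phi> x \<ge> ereal (- \<psi> (norm x))) \<and>
        set_integrable lborel {R1..} (\<lambda>r. \<psi> r * r ^ (CARD('d) - 1)))"


section \<open>Cubes and boundary conditions\<close>

definition cube :: "real \<Rightarrow> (real ^ 'd::finite) set" where
  "cube L = {x. \<forall>i. - L \<le> x $ i \<and> x $ i \<le> L}"

definition cube_volume :: "'d::finite itself \<Rightarrow> real \<Rightarrow> real" where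
  "cube_volume _ L = measure lborel (cube L :: (real ^ 'd) set)"

datatype 'd boundary = Config "(real ^ 'd) set" | Periodic

fun boundary_condition :: "'d::finite boundary \<Rightarrow> bool" where
  "boundary_condition (Config Y) \<longleftrightarrow> (\<forall>K. compact K \<longrightarrow> finite (Y \<inter> K))"
| "boundary_condition Periodic \<longleftrightarrow> True"

text \<open>Sum of a family with values in the extended reals: sum of the positive parts minus sum of the
  negative parts, and infinite as soon as the positive parts diverge. Note that
  \<^const>\<open>e2ennreal\<close> maps negative numbers to 0.\<close>

definition energy_sum :: "('i \<Rightarrow> ereal) \<Rightarrow> 'i set \<Rightarrow> ereal" where
  "energy_sum f A =
     (let P = (\<Sum>\<^sub>\<infinity>i\<in>A. e2ennreal (f i)); M = (\<Sum>\<^sub>\<infinity>i\<in>A. e2ennreal (- f i))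
      in if P = \<infinity> then \<infinity> else enn2ereal P - enn2ereal M)"

text \<open>Two-body interaction and one-body boundary energy in the cube of half-side \<^term>\<open>L\<close>.\<close>

fun pair_interaction ::
    "(real ^ 'd::finite \<Rightarrow> ereal) \<Rightarrow> real \<Rightarrow> 'd boundary \<Rightarrow> real ^ 'd \<Rightarrow> ereal" where
  "pair_interaction \<phi> L (Config Y) x = \<phi> x"
| "pair_interaction \<phi> L Periodic x =
     energy_sum (\<lambda>k. \<phi> (x + k)) {k. \<forall>i. \<exists>m::int. k $ i = 2 * L * real_of_int m}"

fun boundary_energy ::
    "(real ^ 'd::finite \<Rightarrow> ereal) \<Rightarrow> real \<Rightarrow> 'd boundary \<Rightarrow> real ^ 'd \<Rightarrow> ereal" where
  "boundary_energy \<phi> L (Config Y) x = energy_sum (\<lambda>y. \<phi> (x - y)) (Y - cube L)"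
| "boundary_energy \<phi> L Periodic x = 0"


section \<open>Grand canonical partition function and pressure\<close>

definition boltzmann :: "real \<Rightarrow> ereal \<Rightarrow> ennreal" where
  "boltzmann \<beta> E = (case E of ereal e \<Rightarrow> ennreal (exp (- \<beta> * e)) | PInfty \<Rightarrow> 0 | MInfty \<Rightarrow> \<infinity>)"

text \<open>The configuration integral takes values in \<^typ>\<open>ennreal\<close>, where $0\cdot\infty = 0$.\<close>

definition config_integral ::
    "real \<Rightarrow> (real ^ 'd::finite \<Rightarrow> ereal) \<Rightarrow> real \<Rightarrow> 'd boundary \<Rightarrow> nat \<Rightarrow> ennreal" where
  "config_integral \<beta> \<phi> L b N =
     (\<integral>\<^sup>+x. boltzmann \<beta> (pair_energy (pair_interaction \<phi> L b) N x) *
            (\<Prod>i<N. boltzmann \<beta> (boundary_energy \<phi> L b (x i)))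
      \<partial>PiM {..<N} (\<lambda>_. restrict_space lborel (cube L)))"

text \<open>For non-negative fugacity the partition function makes sense as an extended real. For complex
  fugacity it is the corresponding power series, which is meaningful when
  \<^term>\<open>partition_ext \<beta> \<phi> L b r\<close> is finite for all \<^term>\<open>r\<close> (for instance under
  admissibility, for large \<^term>\<open>L\<close>).\<close>

definition gc_term ::
    "real \<Rightarrow> (real ^ 'd::finite \<Rightarrow> ereal) \<Rightarrow> real \<Rightarrow> 'd boundary \<Rightarrow> real \<Rightarrow> nat \<Rightarrow> ennreal" where
  "gc_term \<beta> \<phi> L b x N = ennreal (x ^ N / fact N) * config_integral \<beta> \<phi> L b N"

definition partition_ext ::
    "real \<Rightarrow> (real ^ 'd::finite \<Rightarrow> ereal) \<Rightarrow> real \<Rightarrow> 'd boundary \<Rightarrow> real \<Rightarrow> ennreal" where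
  "partition_ext \<beta> \<phi> L b x = (\<Sum>N. gc_term \<beta> \<phi> L b x N)"

definition partition_fun ::
    "real \<Rightarrow> (real ^ 'd::finite \<Rightarrow> ereal) \<Rightarrow> real \<Rightarrow> 'd boundary \<Rightarrow> complex \<Rightarrow> complex" where
  "partition_fun \<beta> \<phi> L b z =
     (\<Sum>N. z ^ N / fact N * of_real (enn2real (config_integral \<beta> \<phi> L b N)))"

text \<open>Consistency of the two partition functions, and the value 1 of the term $N = 0$.\<close>

lemma config_integral_0: "config_integral \<beta> \<phi> L b 0 = 1"
proof -
  have "boltzmann \<beta> 0 = 1"
    by (simp only: boltzmann_def zero_ereal_def ereal.case) simp
  then show ?thesis
    by (simp add: config_integral_def pair_energy_def PiM_empty)
qed

lemma partition_fun_of_real: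
  assumes "x \<ge> 0" and fin: "partition_ext \<beta> \<phi> L b x < \<infinity>"
  shows "partition_fun \<beta> \<phi> L b (of_real x) = of_real (enn2real (partition_ext \<beta> \<phi> L b x))"
proof -
  let ?t = "\<lambda>N. gc_term \<beta> \<phi> L b x N"
  have "?t N \<noteq> \<infinity>" for N
    using fin ennreal_suminf_lessD[of ?t \<infinity> N] unfolding partition_ext_def by auto
  then have t: "?t N = ennreal (enn2real (?t N))" for N
    by (simp add: less_top)
  have r: "enn2real (?t N) = x ^ N / fact N * enn2real (config_integral \<beta> \<phi> L b N)" for N
    using assms(1) by (simp add: gc_term_def enn2real_mult)
  have fin': "(\<Sum>N. ennreal (enn2real (?t N))) \<noteq> \<infinity>"
    using fin t unfolding partition_ext_def by simp
  have s: "summable (\<lambda>N. enn2real (?t N))"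
    by (rule summable_suminf_not_top) (use fin' in auto)
  have "partition_ext \<beta> \<phi> L b x = (\<Sum>N. ennreal (enn2real (?t N)))"
    using t unfolding partition_ext_def by simp
  also have "\<dots> = ennreal (\<Sum>N. enn2real (?t N))"
    by (rule suminf_ennreal2) (use s in auto)
  finally have "enn2real (partition_ext \<beta> \<phi> L b x) = (\<Sum>N. enn2real (?t N))"
    using s by (simp add: suminf_nonneg)
  moreover have "partition_fun \<beta> \<phi> L b (of_real x) = (\<Sum>N. of_real (enn2real (?t N)))"
    unfolding partition_fun_def r by simp
  ultimately show ?thesis
    by (simp add: suminf_of_real[OF s])
qed

definition ln_ext :: "ennreal \<Rightarrow> ereal" where
  "ln_ext x = (if x = 0 then -\<infinity> else if x = \<infinity> then \<infinity> else ereal (ln (enn2real x)))"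

definition pressure ::
    "real \<Rightarrow> (real ^ 'd::finite \<Rightarrow> ereal) \<Rightarrow> real \<Rightarrow> 'd boundary \<Rightarrow> real \<Rightarrow> ereal" where
  "pressure \<beta> \<phi> L b x = ln_ext (partition_ext \<beta> \<phi> L b x) / ereal (cube_volume TYPE('d) L)"

definition admissible ::
    "real \<Rightarrow> (real ^ 'd::finite \<Rightarrow> ereal) \<Rightarrow> 'd boundary set \<Rightarrow> bool" where
  "admissible \<beta> \<phi> \<B> \<longleftrightarrow>
     (\<exists>c1 c2 L1 :: real. \<forall>z::complex. \<forall>b\<in>\<B>. \<forall>L\<ge>L1. L \<ge> 1 \<longrightarrow>
        pressure \<beta> \<phi> L b (cmod z) \<le> ereal (c1 * cmod z + c2))"

text \<open>A holomorphic branch of the logarithm of the partition function per unit volume on a disc,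
  real at the centre. On the disc such a function is unique.\<close>

definition is_pressure_branch ::
    "real \<Rightarrow> (real ^ 'd::finite \<Rightarrow> ereal) \<Rightarrow> real \<Rightarrow> 'd boundary \<Rightarrow> real \<Rightarrow> real
      \<Rightarrow> (complex \<Rightarrow> complex) \<Rightarrow> bool" where
  "is_pressure_branch \<beta> \<phi> L b z0 \<delta> q \<longleftrightarrow>
     q holomorphic_on ball (of_real z0) \<delta> \<and>
     (\<forall>z\<in>ball (of_real z0) \<delta>.
        exp (of_real (cube_volume TYPE('d) L) * q z) = partition_fun \<beta> \<phi> L b z) \<and>
     q (of_real z0) \<in> \<real>"

definition pressure_branch ::
    "real \<Rightarrow> (real ^ 'd::finite \<Rightarrow> ereal) \<Rightarrow> real \<Rightarrow> 'd boundary \<Rightarrow> real \<Rightarrow> real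
      \<Rightarrow> complex \<Rightarrow> complex" where
  "pressure_branch \<beta> \<phi> L b z0 \<delta> = (SOME q. is_pressure_branch \<beta> \<phi> L b z0 \<delta> q)"


section \<open>Distribution of the particle number\<close>

definition number_dist ::
    "real \<Rightarrow> (real ^ 'd::finite \<Rightarrow> ereal) \<Rightarrow> real \<Rightarrow> 'd boundary \<Rightarrow> real \<Rightarrow> nat measure" where
  "number_dist \<beta> \<phi> L b z =
     density (count_space UNIV) (\<lambda>N. gc_term \<beta> \<phi> L b z N / partition_ext \<beta> \<phi> L b z)"

definition number_mean ::
    "real \<Rightarrow> (real ^ 'd::finite \<Rightarrow> ereal) \<Rightarrow> real \<Rightarrow> 'd boundary \<Rightarrow> real \<Rightarrow> real" where
  "number_mean \<beta> \<phi> L b z = (\<integral>N. real N \<partial>number_dist \<beta> \<phi> L b z)"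

definition number_variance ::
    "real \<Rightarrow> (real ^ 'd::finite \<Rightarrow> ereal) \<Rightarrow> real \<Rightarrow> 'd boundary \<Rightarrow> real \<Rightarrow> real" where
  "number_variance \<beta> \<phi> L b z =
     (\<integral>N. (real N)\<^sup>2 \<partial>number_dist \<beta> \<phi> L b z) - (\<integral>N. real N \<partial>number_dist \<beta> \<phi> L b z)\<^sup>2"

end

(* On a zero-free disc q_L = |\<Lambda>_L|^-1 log \<Xi> is holomorphic. Since the Taylor coefficients of \<Xi> are
   non-negative, Re q_L(z) \<le> |\<Lambda>_L|^-1 log \<Xi>(|z|), which admissibility bounds uniformly in L, and
   q_L(z0) \<ge> 0 because the constant term of \<Xi> is 1. So the Borel-Caratheodory inequality bounds q_L
   locally uniformly. As q_L converges on the real points of the disc, Vitali's theorem gives locally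
   uniform convergence, and Cauchy's estimates pass it on to all derivatives. The mean and the variance
   of the particle number are polynomials in z0 and the derivatives of |\<Lambda>_L| q_L at z0. *)

theory Submission
  imports Defs "HOL-Complex_Analysis.Complex_Analysis"
begin

text \<open>The absence of zeros does not prevent the modulus of Xi from being exponentially small
  in the volume, so away from positive fugacities \<open>Re q_L\<close> has no evident lower bound.
  A one-sided bound on the real part must therefore be turned into a bound on the modulus, starting
  from a centre where q_L is controlled on both sides. The resulting constant blows up at the rim of
  the disc, so all estimates live on compact subsets or strictly smaller discs. There is also a gap
  between branch and hypothesis: convergence is assumed for the real logarithm of Xi, while
  \<open>pressure_branch\<close> is normalised at z0 only. A connectedness argument on the real axis
  closes it.\<close>

section \<open>Normal families\<close>

text \<open>The Moebius map h / (2A - h) sends the half-plane Re h < A into the unit disc and fixes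
  0, so the Schwarz lemma applies after rescaling. Solving back, h = 2A g / (1 + g), and the bound
  on g keeps 1 + g away from 0.\<close>

lemma Borel_Caratheodory_bound:
  assumes hol: "f holomorphic_on ball w R"
    and Re_less: "\<And>z. z \<in> ball w R \<Longrightarrow> Re (f z) < M"
    and rR: "r < R" and z: "dist w z \<le> r"
  shows "cmod (f z - f w) \<le> 2 * r * (M - Re (f w)) / (R - r)"
proof -
  have R: "R > 0" "r \<ge> 0" using z rR zero_le_dist[of w z] by linarith+
  define A where "A = M - Re (f w)"
  have A: "A > 0" using Re_less[of w] R by (simp add: A_def)
  define h where "h u = f (w + of_real R * u) - f w" for u
  have in_ball: "w + of_real R * u \<in> ball w R" if "cmod u < 1" for u
    using that R by (simp add: dist_norm norm_mult)
  have h_Re: "Re (h u) < A" if "cmod u < 1" for u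
    using Re_less[OF in_ball[OF that]] by (simp add: h_def A_def)
  have hhol: "h holomorphic_on ball 0 1"
  proof -
    have "(f \<circ> (\<lambda>u. w + of_real R * u)) holomorphic_on ball 0 1"
      by (rule holomorphic_on_compose_gen[OF _ hol]) (auto intro!: holomorphic_intros in_ball)
    then show ?thesis unfolding h_def comp_def by (intro holomorphic_intros)
  qed
  have nz: "2 * of_real A - h u \<noteq> 0" if "cmod u < 1" for u
  proof
    assume "2 * of_real A - h u = 0"
    then have "Re (2 * of_real A - h u) = 0" by simp
    then show False using h_Re[OF that] A by simp
  qed
  define g where "g u = h u / (2 * of_real A - h u)" for u
  have g1: "cmod (g u) < 1" if u: "cmod u < 1" for u
  proof -
    \<comment> \<open>The difference of the two squares is 4A (A - Re h).\<close>
    have "(cmod (h u))\<^sup>2 < (cmod (2 * of_real A - h u))\<^sup>2"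
      using h_Re[OF u] A unfolding cmod_power2
      by (simp add: power2_eq_square algebra_simps)
    then have "cmod (h u) < cmod (2 * of_real A - h u)"
      using power2_less_imp_less by fastforce
    then show ?thesis using nz[OF u] by (simp add: g_def norm_divide)
  qed
  define u where "u = (z - w) / of_real R"
  have u: "cmod u \<le> r / R" "r / R < 1"
    using z rR R by (simp_all add: u_def norm_divide dist_norm norm_minus_commute divide_right_mono)
  then have u1: "cmod u < 1" by linarith
  have "cmod (g u) \<le> cmod u"
  proof (rule Schwarz_Lemma(1))
    show "g holomorphic_on ball 0 1"
      unfolding g_def using hhol nz by (intro holomorphic_intros) auto
    show "g 0 = 0" by (simp add: g_def h_def)
  qed (use g1 u1 in auto)
  then have g: "cmod (g u) \<le> r / R" using u by linarith
  have "h u * (1 + g u) = 2 * of_real A * g u"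
    using nz[OF u1] by (simp add: g_def field_simps)
  then have "cmod (h u) * cmod (1 + g u) = 2 * A * cmod (g u)"
    using A by (metis abs_of_pos norm_mult norm_numeral norm_of_real)
  moreover have "cmod (1 + g u) \<ge> 1 - r / R"
    using norm_triangle_ineq2[of 1 "- g u"] g by simp
  ultimately have "cmod (h u) * (1 - r / R) \<le> 2 * A * (r / R)"
    using g A by (smt (verit, best) mult_left_mono norm_ge_zero)
  then have "cmod (h u) * (1 - r / R) * R \<le> 2 * A * (r / R) * R"
    using R by (intro mult_right_mono) auto
  moreover have "cmod (h u) * (1 - r / R) * R = cmod (h u) * (R - r)" "2 * A * (r / R) * R = 2 * r * A"
    using R by (simp_all add: field_simps)
  ultimately have "cmod (h u) \<le> 2 * r * A / (R - r)"
    using rR by (simp add: pos_le_divide_eq)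
  moreover have "h u = f z - f w" using R by (simp add: h_def u_def)
  ultimately show ?thesis by (simp add: A_def)
qed

text \<open>All subsequential limits agree on \<open>U\<close>, which accumulates inside the
  connected set \<open>S\<close>, hence they coincide. The parameter is real, so Montel's theorem
  for sequences is applied along arbitrary sequences tending to infinity.\<close>

lemma Vitali_convergence:
  fixes F :: "real \<Rightarrow> complex \<Rightarrow> complex"
  assumes S: "open S" "connected S"
    and hol: "\<And>L. L \<ge> L0 \<Longrightarrow> F L holomorphic_on S"
    and bdd: "\<And>K. \<lbrakk>compact K; K \<subseteq> S\<rbrakk> \<Longrightarrow> \<exists>B. \<forall>L\<ge>L0. \<forall>z\<in>K. cmod (F L z) \<le> B"
    and U: "U \<subseteq> S" "\<xi> \<in> S" "\<xi> islimpt U"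
    and lim: "\<And>z. z \<in> U \<Longrightarrow> ((\<lambda>L. F L z) \<longlongrightarrow> f z) at_top"
  obtains P where "P holomorphic_on S"
    and "\<And>K. \<lbrakk>compact K; K \<subseteq> S\<rbrakk> \<Longrightarrow> uniform_limit K F P at_top"
proof -
  have subseq: "\<exists>g r. g holomorphic_on S \<and> strict_mono r \<and> (\<forall>z\<in>U. g z = f z) \<and>
                  (\<forall>K. compact K \<longrightarrow> K \<subseteq> S \<longrightarrow> uniform_limit K (\<lambda>n. F (X (r n))) g sequentially)"
    if X: "\<And>n. X n \<ge> L0" "filterlim X at_top sequentially" for X :: "nat \<Rightarrow> real"
  proof -
    obtain g r where g: "g holomorphic_on S" "strict_mono (r :: nat \<Rightarrow> nat)"
        "\<And>x. x \<in> S \<Longrightarrow> ((\<lambda>n. F (X (r n)) x) \<longlongrightarrow> g x) sequentially"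
        "\<And>K. \<lbrakk>compact K; K \<subseteq> S\<rbrakk> \<Longrightarrow> uniform_limit K ((\<lambda>n. F (X n)) \<circ> r) g sequentially"
    proof (rule Montel[OF S(1), of "F ` {L0..}" "\<lambda>n. F (X n)"])
      show "range (\<lambda>n. F (X n)) \<subseteq> F ` {L0..}" using X(1) by auto
      show "\<exists>B. \<forall>h\<in>F ` {L0..}. \<forall>z\<in>K. cmod (h z) \<le> B" if "compact K" "K \<subseteq> S" for K
        using bdd[OF that] by auto
    qed (use hol in auto)
    have "g z = f z" if z: "z \<in> U" for z
    proof (rule LIMSEQ_unique)
      show "(\<lambda>n. F (X (r n)) z) \<longlonglongrightarrow> g z" using g(3) z U(1) by auto
      have "filterlim (\<lambda>n. X (r n)) at_top sequentially"
        by (rule filterlim_compose[OF X(2) filterlim_subseq[OF g(2)]])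
      from filterlim_compose[OF lim[OF z] this] show "(\<lambda>n. F (X (r n)) z) \<longlonglongrightarrow> f z" .
    qed
    with g show ?thesis
      by (intro exI[of _ g] exI[of _ r]) (simp add: comp_def)
  qed
  \<comment> \<open>Any sequence tending to infinity supplies the candidate \<open>P\<close>; the
    one chosen here is reused below as a lower bound for the bad sequence.\<close>
  have "filterlim (\<lambda>n. L0 + real n) at_top sequentially"
    by (rule filterlim_tendsto_add_at_top[OF tendsto_const filterlim_real_sequentially])
  from subseq[OF _ this] obtain P where P: "P holomorphic_on S" "\<And>z. z \<in> U \<Longrightarrow> P z = f z"
    by auto
  have "uniform_limit K F P at_top" if K: "compact K" "K \<subseteq> S" for K
  proof (rule ccontr)
    assume "\<not> uniform_limit K F P at_top"
    then obtain e where e: "e > 0" "\<not> (\<forall>\<^sub>F L in at_top. \<forall>z\<in>K. dist (F L z) (P z) < e)"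
      by (auto simp: uniform_limit_iff)
    then have "\<exists>L\<ge>N. \<exists>z\<in>K. dist (F L z) (P z) \<ge> e" for N
      by (auto simp: eventually_at_top_linorder not_less)
    \<comment> \<open>The bound \<open>L0 + real n\<close> does two jobs: it keeps
      \<open>X n\<close> in the range where the family is holomorphic and bounded, and it drives
      \<open>X\<close> to infinity. Every subsequence of \<open>X\<close> then stays at distance
      \<open>e\<close> from \<open>P\<close> somewhere on \<open>K\<close>.\<close>
    then have "\<forall>n. \<exists>L. L \<ge> L0 + real n \<and> (\<exists>z\<in>K. dist (F L z) (P z) \<ge> e)"
      by blast
    from choice[OF this] obtain X where X: "\<And>n. X n \<ge> L0 + real n" "\<And>n. \<exists>z\<in>K. dist (F (X n) z) (P z) \<ge> e"
      by blast
    have "X n \<ge> L0" for n using X(1)[of n] by linarith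
    moreover have "filterlim X at_top sequentially"
      by (rule filterlim_at_top_mono[OF \<open>filterlim (\<lambda>n. L0 + real n) at_top sequentially\<close>])
        (use X(1) in auto)
    ultimately obtain g r where g: "g holomorphic_on S" "\<forall>z\<in>U. g z = f z"
        "uniform_limit K (\<lambda>n. F (X (r n))) g sequentially"
      using subseq[of X] K by blast
    have "g z - P z = 0" if "z \<in> S" for z
      by (rule analytic_continuation[where S = S and U = U and f = "\<lambda>z. g z - P z"])
        (use S U g P that in \<open>auto intro!: holomorphic_intros\<close>)
    then have "uniform_limit K (\<lambda>n. F (X (r n))) P sequentially"
      using g(3) K(2) by (subst uniform_limit_cong'[where g = "\<lambda>n. F (X (r n))" and i = g]) auto
    then obtain n where "\<forall>z\<in>K. dist (F (X (r n)) z) (P z) < e"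
      using e(1) unfolding uniform_limit_iff eventually_sequentially by (meson order_refl)
    with X(2)[of "r n"] show False by force
  qed
  with P(1) show thesis by (rule that)
qed

text \<open>Cauchy's estimate for F L - P on discs of one fixed radius about the points of the small
  ball. The gap between r and s leaves room for these discs inside the region of uniform
  convergence.\<close>

lemma uniform_limit_higher_deriv:
  assumes hol: "\<forall>\<^sub>F L in G. F L holomorphic_on ball w R" "P holomorphic_on ball w R"
    and lim: "uniform_limit (cball w s) F P G"
    and rs: "r < s" "s < R"
  shows "uniform_limit (ball w r) (\<lambda>L. (deriv ^^ n) (F L)) ((deriv ^^ n) P) G"
proof (cases "n = 0")
  case True
  then show ?thesis
    using uniform_limit_on_subset[OF lim, of "ball w r"] rs by (simp add: subset_eq)
next
  case n: False
  define \<rho> where "\<rho> = (s - r) / 2"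
  have \<rho>: "\<rho> > 0" using rs by (simp add: \<rho>_def)
  show ?thesis
  proof (rule uniform_limitI)
    fix e :: real assume e: "e > 0"
    \<comment> \<open>Chosen so that Cauchy's bound \<open>fact n * B / \<rho> ^ n\<close> equals e
      / 2; the factor 2 turns its weak inequality into a strict one.\<close>
    define B where "B = e * \<rho> ^ n / (2 * fact n)"
    have B: "B > 0" using e \<rho> by (simp add: B_def)
    have "\<forall>\<^sub>F L in G. \<forall>z\<in>cball w s. dist (F L z) (P z) < B"
      using lim B by (simp add: uniform_limit_iff)
    with hol(1) show "\<forall>\<^sub>F L in G. \<forall>z\<in>ball w r. dist ((deriv ^^ n) (F L) z) ((deriv ^^ n) P z) < e"
    proof eventually_elim
      case (elim L)
      show ?case
      proof
        fix z assume z: "z \<in> ball w r"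
        have sub: "cball z \<rho> \<subseteq> cball w s"
        proof
          fix x assume "x \<in> cball z \<rho>"
          then have "dist w x < r + \<rho>"
            using z dist_triangle[of w x z] by simp
          also have "r + \<rho> \<le> s" using rs by (simp add: \<rho>_def field_simps)
          finally show "x \<in> cball w s" by simp
        qed
        then have sub': "cball z \<rho> \<subseteq> ball w R"
          using rs by (auto simp: subset_eq)
        have hd: "(\<lambda>x. F L x - P x) holomorphic_on ball w R"
          using elim hol(2) by (intro holomorphic_intros)
        have "cmod ((deriv ^^ n) (\<lambda>x. F L x - P x) z) \<le> fact n * B / \<rho> ^ n"
        proof (rule Cauchy_higher_deriv_bound[where y = 0])
          show "(\<lambda>x. F L x - P x) holomorphic_on ball z \<rho>"
            using hd by (rule holomorphic_on_subset) (use sub' in auto)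
          show "continuous_on (cball z \<rho>) (\<lambda>x. F L x - P x)"
            by (rule holomorphic_on_imp_continuous_on, rule holomorphic_on_subset[OF hd sub'])
          show "F L x - P x \<in> ball 0 B" if "x \<in> ball z \<rho>" for x
          proof -
            have "x \<in> cball w s" using that sub ball_subset_cball by blast
            then show ?thesis using elim(2) by (simp add: dist_norm norm_minus_commute)
          qed
        qed (use \<rho> n in auto)
        also have "fact n * B / \<rho> ^ n = e / 2" using \<rho> by (simp add: B_def)
        also have "\<dots> < e" using e by simp
        finally show "dist ((deriv ^^ n) (F L) z) ((deriv ^^ n) P z) < e"
          using higher_deriv_diff[OF elim(1) hol(2) open_ball, of z n] z rs
          by (simp add: dist_norm)
      qed
    qed
  qed
qed

section \<open>Entire power series\<close>

text \<open>The Euler operator z d/dz multiplies the n-th coefficient by n, which is how moments of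
  the particle number arise. The derivative is left as an unnamed \<open>D\<close>, so that
  uniqueness of derivatives can match it with any other formula.\<close>

lemma powser_euler:
  fixes c :: "nat \<Rightarrow> complex"
  assumes sm: "\<And>z. summable (\<lambda>n. c n * z ^ n)"
  obtains D where "((\<lambda>z. \<Sum>n. c n * z ^ n) has_field_derivative D) (at z)"
    and "(\<lambda>n. of_nat n * c n * z ^ n) sums (z * D)"
proof -
  have "(\<lambda>n. diffs c n * z ^ n) sums (\<Sum>n. diffs c n * z ^ n)"
    using termdiff_converges_all[OF sm] by (rule summable_sums)
  then have "(\<lambda>n. z * (diffs c n * z ^ n)) sums (z * (\<Sum>n. diffs c n * z ^ n))"
    by (rule sums_mult)
  then have "(\<lambda>n. of_nat (Suc n) * c (Suc n) * z ^ Suc n) sums (z * (\<Sum>n. diffs c n * z ^ n))"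
    by (simp add: diffs_def mult_ac)
  \<comment> \<open>The index shift is free because the term with n = 0 vanishes.\<close>
  then have "(\<lambda>n. of_nat n * c n * z ^ n) sums (z * (\<Sum>n. diffs c n * z ^ n))"
    by (subst (asm) sums_Suc_iff) simp
  with termdiffs_strong_converges_everywhere[OF sm] show thesis by (rule that)
qed

lemma has_real_derivative_Re_of_real:
  assumes "(H has_field_derivative D) (at (complex_of_real x))"
  shows "((\<lambda>t. Re (H (of_real t))) has_real_derivative Re D) (at x)"
  using bounded_linear.has_vector_derivative[OF bounded_linear_Re has_vector_derivative_real_field[OF assms]]
  by (simp add: has_real_derivative_iff_has_vector_derivative)

section \<open>The finite-volume partition function\<close>

lemma cube_volume_pos:
  assumes "L > 0"
  shows "cube_volume TYPE('d::finite) L > 0"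
proof -
  have "cube L = cbox (\<chi> i. - L) (\<chi> i. L :: real ^ 'd)"
    by (auto simp: cube_def mem_box_cart)
  moreover have "measure lborel (cbox (\<chi> i. - L) (\<chi> i. L :: real ^ 'd)) > 0"
    using assms by (subst content_pos_lt_eq) (auto simp: Basis_vec_def inner_axis)
  ultimately show ?thesis by (simp add: cube_volume_def)
qed

lemma partition_ext_ge_1: "partition_ext \<beta> \<phi> L b x \<ge> 1"
proof -
  have "(\<Sum>N<1. gc_term \<beta> \<phi> L b x N) \<le> (\<Sum>N. gc_term \<beta> \<phi> L b x N)"
    by (rule sum_le_suminf) auto
  then show ?thesis by (simp add: partition_ext_def gc_term_def config_integral_0)
qed

text \<open>The power series coefficients of Xi as reals. An infinite configuration integral would
  become 0 here, but none occurs when \<open>partition_ext\<close> is finite at some x > 0, and at x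
  = 0 only the term N = 0 counts.\<close>

abbreviation gc_coeff ::
    "real \<Rightarrow> (real ^ 'd::finite \<Rightarrow> ereal) \<Rightarrow> real \<Rightarrow> 'd boundary \<Rightarrow> nat \<Rightarrow> real" where
  "gc_coeff \<beta> \<phi> L b N \<equiv> enn2real (config_integral \<beta> \<phi> L b N) / fact N"

lemma gc_term_eq:
  assumes "x \<ge> 0" and fin: "partition_ext \<beta> \<phi> L b x < \<infinity>"
  shows "gc_term \<beta> \<phi> L b x N = ennreal (gc_coeff \<beta> \<phi> L b N * x ^ N)"
proof -
  have "gc_term \<beta> \<phi> L b x N \<noteq> \<infinity>"
    using fin ennreal_suminf_lessD[of "gc_term \<beta> \<phi> L b x" \<infinity> N] unfolding partition_ext_def by auto
  then have "gc_term \<beta> \<phi> L b x N = ennreal (enn2real (gc_term \<beta> \<phi> L b x N))"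
    by (simp add: less_top)
  also have "enn2real (gc_term \<beta> \<phi> L b x N) = gc_coeff \<beta> \<phi> L b N * x ^ N"
    using assms(1) by (simp add: gc_term_def enn2real_mult)
  finally show ?thesis .
qed

lemma gc_coeff_sums:
  assumes "x \<ge> 0" and fin: "partition_ext \<beta> \<phi> L b x < \<infinity>"
  shows "(\<lambda>N. gc_coeff \<beta> \<phi> L b N * x ^ N) sums enn2real (partition_ext \<beta> \<phi> L b x)"
proof -
  let ?t = "\<lambda>N. gc_coeff \<beta> \<phi> L b N * x ^ N"
  have eq: "partition_ext \<beta> \<phi> L b x = (\<Sum>N. ennreal (?t N))"
    unfolding partition_ext_def gc_term_eq[OF assms] ..
  have nn: "?t N \<ge> 0" for N using assms(1) by simp
  have s: "summable ?t"
    by (rule summable_suminf_not_top) (use fin eq nn in auto)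
  have "partition_ext \<beta> \<phi> L b x = ennreal (\<Sum>N. ?t N)"
    unfolding eq by (rule suminf_ennreal2) (use s nn in auto)
  with s nn show ?thesis by (simp add: summable_sums suminf_nonneg)
qed

text \<open>One cube with one boundary condition. Finiteness at every non-negative fugacity makes Xi
  an entire function, so that it may be differentiated term by term.\<close>

locale finite_partition =
  fixes \<beta> :: real and \<phi> :: "real ^ 'd::finite \<Rightarrow> ereal" and L :: real and b :: "'d boundary"
  assumes L_pos: "L > 0"
    and finite: "\<And>x. x \<ge> 0 \<Longrightarrow> partition_ext \<beta> \<phi> L b x < \<infinity>"
begin

abbreviation "c \<equiv> gc_coeff \<beta> \<phi> L b"

definition Xi :: "real \<Rightarrow> real" where
  "Xi x = enn2real (partition_ext \<beta> \<phi> L b x)"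

lemma V_pos: "cube_volume TYPE('d) L > 0"
  by (rule cube_volume_pos[OF L_pos])

lemma partition_ext_eq: "x \<ge> 0 \<Longrightarrow> partition_ext \<beta> \<phi> L b x = ennreal (Xi x)"
  using finite by (simp add: Xi_def less_top)

lemma Xi_ge_1: "x \<ge> 0 \<Longrightarrow> Xi x \<ge> 1"
  using partition_ext_ge_1[of \<beta> \<phi> L b x] by (simp add: partition_ext_eq)

lemma Xi_sums: "x \<ge> 0 \<Longrightarrow> (\<lambda>N. c N * x ^ N) sums Xi x"
  unfolding Xi_def using finite by (rule gc_coeff_sums[rotated])

lemma partition_fun_eq: "partition_fun \<beta> \<phi> L b = (\<lambda>z. \<Sum>N. of_real (c N) * z ^ N)"
  by (intro ext) (simp add: partition_fun_def mult_ac)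

lemma summable_norm_c: "summable (\<lambda>N. norm (of_real (c N) * z ^ N :: complex))"
  using sums_summable[OF Xi_sums[of "norm z"]] by (simp add: norm_mult norm_power norm_divide)

lemma summable_c: "summable (\<lambda>N. of_real (c N) * z ^ N :: complex)"
  by (rule summable_norm_cancel[OF summable_norm_c])

lemma partition_fun_of_real': "x \<ge> 0 \<Longrightarrow> partition_fun \<beta> \<phi> L b (of_real x) = of_real (Xi x)"
  unfolding Xi_def by (rule partition_fun_of_real[OF _ finite])

lemma norm_partition_fun_le: "cmod (partition_fun \<beta> \<phi> L b z) \<le> Xi (cmod z)"
proof -
  have "cmod (partition_fun \<beta> \<phi> L b z) \<le> (\<Sum>N. cmod (of_real (c N) * z ^ N))"
    unfolding partition_fun_eq by (rule summable_norm[OF summable_norm_c])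
  also have "\<dots> = (\<Sum>N. c N * cmod z ^ N)" by (simp add: norm_mult norm_power norm_divide)
  also have "\<dots> = Xi (cmod z)" using Xi_sums[of "cmod z"] by (simp add: sums_iff)
  finally show ?thesis .
qed

lemma partition_fun_holomorphic: "partition_fun \<beta> \<phi> L b holomorphic_on S"
proof -
  have "\<exists>D. (partition_fun \<beta> \<phi> L b has_field_derivative D) (at z)" for z
    unfolding partition_fun_eq by (rule powser_euler[OF summable_c, of z]) auto
  then show ?thesis
    by (metis DERIV_subset field_differentiable_def holomorphic_on_def subset_UNIV)
qed

lemma pressure_eq: "x \<ge> 0 \<Longrightarrow> pressure \<beta> \<phi> L b x = ereal (ln (Xi x) / cube_volume TYPE('d) L)"
  using partition_ext_eq[of x] Xi_ge_1[of x] V_pos by (auto simp: pressure_def ln_ext_def)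

text \<open>Summability has to be supplied because the Bochner integral of a non-integrable function
  is 0 by default. It will come from \<open>powser_euler\<close>.\<close>

lemma moment_eq:
  assumes x: "x > 0" and s: "summable (\<lambda>N. real N ^ k * c N * x ^ N)"
  shows "(\<integral>N. real N ^ k \<partial>number_dist \<beta> \<phi> L b x) = (\<Sum>N. real N ^ k * c N * x ^ N) / Xi x"
proof -
  let ?w = "\<lambda>N. c N * x ^ N / Xi x"
  have Xi: "Xi x > 0" using Xi_ge_1[of x] x by simp
  have w: "gc_term \<beta> \<phi> L b x N / partition_ext \<beta> \<phi> L b x = ennreal (?w N)" for N
    using x Xi gc_term_eq[of x, OF _ finite] by (simp add: partition_ext_eq divide_ennreal)
  have eq: "?w N *\<^sub>R real N ^ k = real N ^ k * c N * x ^ N / Xi x" for N by simp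
  have "(\<integral>N. real N ^ k \<partial>number_dist \<beta> \<phi> L b x) = (\<integral>N. ?w N *\<^sub>R real N ^ k \<partial>count_space UNIV)"
    unfolding number_dist_def w by (rule integral_density) (use x Xi in auto)
  also have "\<dots> = (\<Sum>N. real N ^ k * c N * x ^ N / Xi x)"
    unfolding eq using summable_divide[OF s, of "Xi x"] x Xi
    by (intro integral_count_space_nat) (simp add: integrable_count_space_nat_iff)
  finally show ?thesis using suminf_divide[OF s, of "Xi x"] by simp
qed

section \<open>Holomorphic branches of the finite-volume pressure\<close>

text \<open>At positive fugacity Xi is positive, so the imaginary part of V q is a multiple of 2 pi.
  Being continuous along the real segment from z0 to x, it keeps its value at z0, which is
  0.\<close>

lemma branch_of_real:
  assumes q: "is_pressure_branch \<beta> \<phi> L b z0 \<delta> q" and z0: "z0 > 0" "\<delta> > 0"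
    and x: "x > 0" "complex_of_real x \<in> ball (of_real z0) \<delta>"
  shows "q (of_real x) = of_real (ln (Xi x) / cube_volume TYPE('d) L)"
proof -
  have hol: "q holomorphic_on ball (of_real z0) \<delta>"
    and ex: "\<And>z. z \<in> ball (of_real z0) \<delta> \<Longrightarrow> exp (of_real (cube_volume TYPE('d) L) * q z) = partition_fun \<beta> \<phi> L b z"
    and re: "q (of_real z0) \<in> \<real>"
    using q by (auto simp: is_pressure_branch_def)
  \<comment> \<open>The disc may reach past 0; the segment between two positive points of it stays
    both in the disc and among the positive fugacities.\<close>
  define I where "I = closed_segment z0 x"
  have I: "t > 0" "complex_of_real t \<in> ball (of_real z0) \<delta>" if "t \<in> I" for t
  proof -
    show "t > 0" using that z0 x by (auto simp: I_def closed_segment_eq_real_ivl split: if_splits)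
    have "dist z0 t \<le> dist z0 x"
      using that by (auto simp: I_def closed_segment_eq_real_ivl dist_real_def split: if_splits)
    then show "complex_of_real t \<in> ball (of_real z0) \<delta>" using x by (simp add: dist_of_real)
  qed
  define h where "h t = cube_volume TYPE('d) L * Im (q (of_real t))" for t
  have Re_q: "Re (q (of_real t)) = ln (Xi t) / cube_volume TYPE('d) L" and Im_q: "\<exists>m::int. h t = of_int (2 * m) * pi"
    if t: "t \<in> I" for t
  proof -
    have X: "Xi t > 0" using Xi_ge_1[of t] I[OF t] by simp
    have e: "exp (of_real (cube_volume TYPE('d) L) * q (of_real t)) = of_real (Xi t)"
      using ex[OF I(2)[OF t]] I(1)[OF t] by (simp add: partition_fun_of_real')
    then have "exp (cube_volume TYPE('d) L * Re (q (of_real t))) = Xi t"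
      using X by (metis Re_complex_of_real abs_of_pos norm_exp_eq_Re norm_of_real times_complex.sel(1) 
          Im_complex_of_real mult_zero_left diff_zero)
    then have "cube_volume TYPE('d) L * Re (q (of_real t)) = ln (Xi t)" by (metis ln_exp)
    then show "Re (q (of_real t)) = ln (Xi t) / cube_volume TYPE('d) L" using V_pos by (simp add: field_simps)
    have "exp (of_real (cube_volume TYPE('d) L) * q (of_real t)) = exp (of_real (ln (Xi t)))"
      using e X by (simp add: exp_of_real)
    then obtain m :: int where
      "of_real (cube_volume TYPE('d) L) * q (of_real t) = of_real (ln (Xi t)) + of_int (2 * m) * pi * \<i>"
      unfolding exp_eq by blast
    from arg_cong[OF this, of Im] show "\<exists>m::int. h t = of_int (2 * m) * pi"
      unfolding h_def by (intro exI[of _ m]) simp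
  qed
  have "h constant_on I"
  proof (rule continuous_discrete_range_constant)
    show "connected I" by (simp add: I_def)
    have "continuous_on (ball (of_real z0) \<delta>) q" by (rule holomorphic_on_imp_continuous_on[OF hol])
    then have "continuous_on I (\<lambda>t. q (of_real t))"
      by (rule continuous_on_compose2) (auto intro!: continuous_intros I)
    then show "continuous_on I h" unfolding h_def by (intro continuous_intros)
    \<comment> \<open>Distinct values of \<open>h\<close> are distinct multiples of 2 pi, so 2 pi
      itself serves as the gap.\<close>
    show "\<exists>e>0. \<forall>y. y \<in> I \<and> h y \<noteq> h t \<longrightarrow> e \<le> norm (h y - h t)" if t: "t \<in> I" for t
    proof (intro exI[of _ "2 * pi"] conjI allI impI)
      fix y assume y: "y \<in> I \<and> h y \<noteq> h t"
      obtain m n :: int where mn: "h y = of_int (2 * m) * pi" "h t = of_int (2 * n) * pi"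
        using Im_q t y by blast
      then have "m \<noteq> n" using y by auto
      then have "\<bar>of_int (m - n)\<bar> \<ge> (1::real)" by linarith
      moreover have "h y - h t = of_int (m - n) * (2 * pi)"
        unfolding mn by (simp add: algebra_simps)
      then have "norm (h y - h t) = \<bar>of_int (m - n)\<bar> * (2 * pi)"
        by (simp only: real_norm_def abs_mult) simp
      ultimately show "2 * pi \<le> norm (h y - h t)"
        using mult_right_mono[of 1 "\<bar>of_int (m - n)\<bar>::real" "2 * pi"] by simp
    qed simp
  qed
  moreover have "z0 \<in> I" "x \<in> I" by (auto simp: I_def)
  ultimately have "h x = h z0" by (auto simp: constant_on_def)
  also have "h z0 = 0" using re by (simp add: h_def complex_is_Real_iff)
  finally have "Im (q (of_real x)) = 0" using V_pos by (simp add: h_def)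
  with Re_q[OF \<open>x \<in> I\<close>] show ?thesis by (simp add: complex_eq_iff)
qed

text \<open>Needed to give the \<open>SOME\<close> in \<open>pressure_branch\<close> a meaning. A
  holomorphic logarithm exists because the disc is contractible; it is fixed only up to a constant,
  which is adjusted so that the value at z0 is the real logarithm.\<close>

lemma branch_exists:
  assumes nz: "\<And>z. z \<in> ball (of_real z0) \<delta> \<Longrightarrow> partition_fun \<beta> \<phi> L b z \<noteq> 0" and z0: "z0 > 0" "\<delta> > 0"
  shows "\<exists>q. is_pressure_branch \<beta> \<phi> L b z0 \<delta> q"
proof -
  obtain g where g: "g holomorphic_on ball (of_real z0) \<delta>"
      "\<And>z. z \<in> ball (of_real z0) \<delta> \<Longrightarrow> partition_fun \<beta> \<phi> L b z = exp (g z)"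
    using contractible_imp_holomorphic_log[OF partition_fun_holomorphic
        convex_imp_contractible[OF convex_ball] nz] by metis
  have X: "Xi z0 > 0" using Xi_ge_1[of z0] z0 by simp
  have gz0: "exp (g (of_real z0)) = of_real (Xi z0)"
    using g(2)[of "of_real z0"] z0 by (simp add: partition_fun_of_real')
  define q where "q z = (g z - g (of_real z0) + of_real (ln (Xi z0))) / of_real (cube_volume TYPE('d) L)" for z
  have "exp (of_real (cube_volume TYPE('d) L) * q z) = partition_fun \<beta> \<phi> L b z" if "z \<in> ball (of_real z0) \<delta>" for z
  proof -
    have "of_real (cube_volume TYPE('d) L) * q z = g z - g (of_real z0) + of_real (ln (Xi z0))"
      using V_pos by (simp add: q_def)
    then show ?thesis
      using X g(2)[OF that] by (simp add: exp_add exp_diff gz0 exp_of_real)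
  qed
  moreover have "q holomorphic_on ball (of_real z0) \<delta>"
    unfolding q_def using g V_pos by (intro holomorphic_intros) auto
  moreover have "q (of_real z0) \<in> \<real>" by (simp add: q_def)
  ultimately show ?thesis by (auto simp: is_pressure_branch_def)
qed

lemma branch_Re_le:
  assumes q: "is_pressure_branch \<beta> \<phi> L b z0 \<delta> q" and z: "z \<in> ball (of_real z0) \<delta>"
  shows "Re (q z) \<le> ln (Xi (cmod z)) / cube_volume TYPE('d) L"
proof -
  have "exp (cube_volume TYPE('d) L * Re (q z)) = cmod (exp (of_real (cube_volume TYPE('d) L) * q z))" by simp
  also have "\<dots> \<le> Xi (cmod z)"
    using q z norm_partition_fun_le by (simp add: is_pressure_branch_def)
  finally have "cube_volume TYPE('d) L * Re (q z) \<le> ln (Xi (cmod z))"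
    using Xi_ge_1[of "cmod z"] by (metis exp_gt_zero ln_exp ln_le_cancel_iff order_less_le_trans)
  then show ?thesis using V_pos by (simp add: field_simps)
qed

text \<open>With \<open>D = z d/dz\<close>, the first two cumulants of the particle number are \<open>D\<close> and \<open>D\<^sup>2\<close> applied to
  \<open>log \<Xi> = V q\<close>.\<close>

lemma branch_cumulants:
  assumes q: "is_pressure_branch \<beta> \<phi> L b z0 \<delta> q" and z0: "z0 > 0" "\<delta> > 0"
  shows "number_mean \<beta> \<phi> L b z0 = cube_volume TYPE('d) L * (z0 * Re (deriv q z0))"
    and "number_variance \<beta> \<phi> L b z0 =
      cube_volume TYPE('d) L * (z0 * Re (deriv q z0) + z0\<^sup>2 * Re ((deriv ^^ 2) q z0))"
proof -
  let ?B = "ball (complex_of_real z0) \<delta>"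
  let ?F = "partition_fun \<beta> \<phi> L b"
  have hol: "q holomorphic_on ?B" and ex: "\<And>z. z \<in> ?B \<Longrightarrow> exp (of_real (cube_volume TYPE('d) L) * q z) = ?F z"
    using q by (auto simp: is_pressure_branch_def)
  have hol': "deriv q holomorphic_on ?B" by (rule holomorphic_deriv[OF hol open_ball])
  have dq: "(q has_field_derivative deriv q z) (at z)" if "z \<in> ?B" for z
    by (rule holomorphic_derivI[OF hol open_ball that])
  have dq': "(deriv q has_field_derivative (deriv ^^ 2) q z) (at z)" if "z \<in> ?B" for z
    using holomorphic_derivI[OF hol' open_ball that] by (simp add: numeral_2_eq_2)
  have dF: "(?F has_field_derivative of_real (cube_volume TYPE('d) L) * deriv q z * ?F z) (at z)" if z: "z \<in> ?B" for z
  proof -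
    have "((\<lambda>z. exp (of_real (cube_volume TYPE('d) L) * q z)) has_field_derivative of_real (cube_volume TYPE('d) L) * deriv q z * ?F z) (at z)"
      using z by (auto intro!: derivative_eq_intros dq simp flip: ex)
    then show ?thesis
      by (rule has_field_derivative_transform_within_open[OF _ open_ball z]) (use ex in auto)
  qed
  \<comment> \<open>\<open>G\<close> is z Xi'(z) as a power series; applying
    \<open>powser_euler\<close> to it once more produces the factor N squared of the second
    moment.\<close>
  define G where "G z = (\<Sum>N. of_nat N * of_real (c N) * z ^ N)" for z :: complex
  have sums1: "(\<lambda>N. of_nat N * of_real (c N) * z ^ N) sums (z * (of_real (cube_volume TYPE('d) L) * deriv q z * ?F z))"
    if z: "z \<in> ?B" for z
    by (rule powser_euler[OF summable_c, of z])
      \<comment> \<open>The derivative of the series is identified with the one computed from exp (V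
        q).\<close>
      (use DERIV_unique[OF _ dF[OF z]] in \<open>auto simp: partition_fun_eq\<close>)
  have summable1: "summable (\<lambda>N. (of_nat N * of_real (c N)) * z ^ N)" for z :: complex
    by (rule powser_euler[OF summable_c, of z]) (auto dest: sums_summable)
  have G_eq: "G z = z * (of_real (cube_volume TYPE('d) L) * deriv q z * ?F z)" if "z \<in> ?B" for z
    using sums1[OF that] by (simp add: G_def sums_iff)
  let ?z = "complex_of_real z0"
  have zB: "?z \<in> ?B" using z0 by simp
  \<comment> \<open>\<open>Q\<close> and \<open>Q2\<close> are the first two derivatives of log Xi =
    V q at z0. In the second moment the term with \<open>Q\<^sup>2\<close> is the squared mean,
    which cancels in the variance.\<close>
  define Q where "Q = of_real (cube_volume TYPE('d) L) * deriv q ?z"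
  define Q2 where "Q2 = of_real (cube_volume TYPE('d) L) * (deriv ^^ 2) q ?z"
  have dG: "(G has_field_derivative (Q + ?z * Q2 + ?z * Q\<^sup>2) * ?F ?z) (at ?z)"
  proof -
    have "((\<lambda>z. z * (of_real (cube_volume TYPE('d) L) * deriv q z * ?F z)) has_field_derivative
        (Q + ?z * Q2 + ?z * Q\<^sup>2) * ?F ?z) (at ?z)"
      unfolding Q_def Q2_def
      by (auto intro!: derivative_eq_intros dq' dF zB simp: algebra_simps power2_eq_square)
    then show ?thesis
      by (rule has_field_derivative_transform_within_open[OF _ open_ball zB]) (use G_eq in auto)
  qed
  have sums2: "(\<lambda>N. of_nat N * (of_nat N * of_real (c N)) * ?z ^ N) sums
      (?z * ((Q + ?z * Q2 + ?z * Q\<^sup>2) * ?F ?z))"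
    by (rule powser_euler[OF summable1, of ?z])
      (use DERIV_unique[OF _ dG] in \<open>auto simp: G_def[abs_def]\<close>)
  have X: "Xi z0 > 0" "?F ?z = of_real (Xi z0)"
    using Xi_ge_1[of z0] z0 by (simp_all add: partition_fun_of_real')
  have "(\<lambda>N. of_real (real N ^ 1 * c N * z0 ^ N)) sums (?z * Q * ?F ?z)"
    using sums1[OF zB] by (simp add: Q_def mult_ac)
  from sums_Re[OF this] have m1: "(\<lambda>N. real N ^ 1 * c N * z0 ^ N) sums (Xi z0 * Re (?z * Q))"
    unfolding X(2) Re_complex_of_real by (simp add: mult_ac)
  have "(\<lambda>N. of_real (real N ^ 2 * c N * z0 ^ N)) sums (?z * ((Q + ?z * Q2 + ?z * Q\<^sup>2) * ?F ?z))"
    using sums2 by (simp add: power2_eq_square mult_ac)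
  from sums_Re[OF this]
  have m2: "(\<lambda>N. real N ^ 2 * c N * z0 ^ N) sums (Xi z0 * Re (?z * (Q + ?z * Q2 + ?z * Q\<^sup>2)))"
    unfolding X(2) Re_complex_of_real by (simp add: mult_ac)
  have E1: "(\<integral>N. real N \<partial>number_dist \<beta> \<phi> L b z0) = Re (?z * Q)"
    using moment_eq[OF z0(1) sums_summable[OF m1]] X(1)
    unfolding sums_unique[OF m1, symmetric] by simp
  have E2: "(\<integral>N. (real N)\<^sup>2 \<partial>number_dist \<beta> \<phi> L b z0) = Re (?z * (Q + ?z * Q2 + ?z * Q\<^sup>2))"
    using moment_eq[OF z0(1) sums_summable[OF m2]] X(1)
    unfolding sums_unique[OF m2, symmetric] by simp
  \<comment> \<open>The second moment contains the real part of a square, the variance subtracts the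
    square of a real part; the two agree only because \<open>Q\<close> is real.\<close>
  have "Im (?z * Q) = 0"
  proof -
    have "(\<lambda>N. of_real (real N ^ 1 * c N * z0 ^ N)) sums (?z * Q * ?F ?z)"
      using sums1[OF zB] by (simp add: Q_def mult_ac)
    from sums_Im[OF this] have "(\<lambda>N. 0) sums Im (?z * Q * ?F ?z)"
      unfolding Im_complex_of_real .
    then have "Im (?z * Q * ?F ?z) = 0" using sums_unique2 sums_zero by blast
    then show ?thesis using X by simp
  qed
  then have "Im Q = 0" using z0 by simp
  then have "Re (Q\<^sup>2) = (Re Q)\<^sup>2" by (simp add: power2_eq_square)
  then show "number_variance \<beta> \<phi> L b z0 =
      cube_volume TYPE('d) L * (z0 * Re (deriv q z0) + z0\<^sup>2 * Re ((deriv ^^ 2) q z0))"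
    unfolding number_variance_def E1 E2
    by (simp add: Q_def Q2_def algebra_simps power2_eq_square)
  show "number_mean \<beta> \<phi> L b z0 = cube_volume TYPE('d) L * (z0 * Re (deriv q z0))"
    unfolding number_mean_def E1 by (simp add: Q_def)
qed

end

section \<open>Finite partition functions from admissibility\<close>

lemma admissible_imp_finite_partition:
  assumes "admissible \<beta> \<phi> \<B>" "b \<in> \<B>"
  obtains c1 c2 L1 where "L1 \<ge> 1"
    "\<And>L. L \<ge> L1 \<Longrightarrow> finite_partition \<beta> \<phi> L b"
    "\<And>L r. \<lbrakk>L \<ge> L1; r \<ge> 0\<rbrakk> \<Longrightarrow> pressure \<beta> \<phi> L b r \<le> ereal (c1 * r + c2)"
proof -
  obtain c1 c2 L0 where adm: "\<And>z L. \<lbrakk>L \<ge> L0; L \<ge> 1\<rbrakk> \<Longrightarrow>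
      pressure \<beta> \<phi> L b (cmod z) \<le> ereal (c1 * cmod z + c2)"
    using assms unfolding admissible_def by blast
  show thesis
  proof (rule that[of "max 1 L0" c1 c2])
    fix L :: real assume L: "L \<ge> max 1 L0"
    show le: "pressure \<beta> \<phi> L b r \<le> ereal (c1 * r + c2)" if "r \<ge> 0" for r
      using adm[of L "of_real r"] that L by simp
    show "finite_partition \<beta> \<phi> L b"
    proof
      show "L > 0" using L by simp
      fix x :: real assume x: "x \<ge> 0"
      have V: "cube_volume TYPE('a) L > 0" using L by (intro cube_volume_pos) simp
      show "partition_ext \<beta> \<phi> L b x < \<infinity>"
      proof (rule ccontr)
        assume "\<not> ?thesis"
        \<comment> \<open>Division by the positive volume preserves infinity, which contradicts the
          finite bound on the pressure.\<close>
        then have "pressure \<beta> \<phi> L b x = \<infinity>"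
          using V by (simp add: pressure_def ln_ext_def less_top)
        with le[OF x] show False by simp
      qed
    qed
  qed simp
qed

section \<open>The thermodynamic limit\<close>

text \<open>\<open>p\<close> is a real function known only to agree with \<open>P\<close> on
  positive points of the disc, so the chain rule is applied to P (exp (\<beta> w)) for complex w and
  then restricted to the real line. As d/d\<mu> is \<beta> z d/dz, the second derivative acquires a
  first-order term, just as the variance does.\<close>

lemma pressure_derivatives_mu:
  assumes P: "P holomorphic_on ball (complex_of_real z0) r" and r: "r > 0" and z0: "z0 > 0"
    and Pp: "\<And>x. \<lbrakk>x > 0; complex_of_real x \<in> ball (of_real z0) r\<rbrakk> \<Longrightarrow> P (of_real x) = of_real (p x)"
    and "\<beta> > 0" and \<mu>0: "\<mu>0 = ln z0 / \<beta>"
  shows "deriv (\<lambda>\<mu>. p (exp (\<beta> * \<mu>))) \<mu>0 = \<beta> * (z0 * Re (deriv P z0))"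
    and "(deriv ^^ 2) (\<lambda>\<mu>. p (exp (\<beta> * \<mu>))) \<mu>0 =
      \<beta>\<^sup>2 * (z0 * Re (deriv P z0) + z0\<^sup>2 * Re ((deriv ^^ 2) P z0))"
proof -
  let ?B = "ball (complex_of_real z0) r"
  let ?e = "\<lambda>\<mu>::real. exp (of_real \<beta> * complex_of_real \<mu>)"
  have e_eq: "?e \<mu> = of_real (exp (\<beta> * \<mu>))" for \<mu> by (simp flip: exp_of_real)
  have e0: "exp (\<beta> * \<mu>0) = z0" using \<mu>0 z0 \<open>\<beta> > 0\<close> by simp
  \<comment> \<open>A whole neighbourhood of \<mu>0 is required: the formula for the first
    derivative must hold on an open set before it can be differentiated again.\<close>
  define W where "W = (\<lambda>\<mu>. exp (\<beta> * \<mu>)) -` ball z0 r"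
  have W: "open W" "\<mu>0 \<in> W"
    unfolding W_def using r e0 by (auto intro!: open_vimage continuous_intros)
  have WB: "?e \<mu> \<in> ?B" if "\<mu> \<in> W" for \<mu>
    using that unfolding e_eq by (simp add: W_def dist_of_real)
  have dP: "(P has_field_derivative deriv P z) (at z)" if "z \<in> ?B" for z
    by (rule holomorphic_derivI[OF P open_ball that])
  have dP': "(deriv P has_field_derivative (deriv ^^ 2) P z) (at z)" if "z \<in> ?B" for z
    using holomorphic_derivI[OF holomorphic_deriv[OF P open_ball] open_ball that]
    by (simp add: numeral_2_eq_2)
  define g where "g \<mu> = Re (of_real \<beta> * ?e \<mu> * deriv P (?e \<mu>))" for \<mu>
  have d1: "((\<lambda>\<mu>. p (exp (\<beta> * \<mu>))) has_real_derivative g \<mu>) (at \<mu>)" if \<mu>: "\<mu> \<in> W" for \<mu>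
  proof -
    have "((\<lambda>w. P (exp (of_real \<beta> * w))) has_field_derivative
        deriv P (?e \<mu>) * (?e \<mu> * of_real \<beta>)) (at (complex_of_real \<mu>))"
      by (rule DERIV_chain2[where f = P and g = "\<lambda>w. exp (of_real \<beta> * w)", OF dP[OF WB[OF \<mu>]]]) (auto intro!: derivative_eq_intros)
    then have "((\<lambda>\<mu>. Re (P (?e \<mu>))) has_real_derivative Re (deriv P (?e \<mu>) * (?e \<mu> * of_real \<beta>))) (at \<mu>)"
      by (rule has_real_derivative_Re_of_real)
    then have "((\<lambda>\<mu>. Re (P (?e \<mu>))) has_real_derivative g \<mu>) (at \<mu>)"
      by (simp only: g_def mult_ac)
    moreover have "Re (P (?e \<nu>)) = p (exp (\<beta> * \<nu>))" if "\<nu> \<in> W" for \<nu>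
      using Pp[of "exp (\<beta> * \<nu>)"] WB[OF that] unfolding e_eq by simp
    ultimately show ?thesis
      by (rule has_field_derivative_transform_within_open[OF _ W(1) \<mu>])
  qed
  have deriv_g: "deriv (\<lambda>\<mu>. p (exp (\<beta> * \<mu>))) \<mu> = g \<mu>" if "\<mu> \<in> W" for \<mu>
    by (rule DERIV_imp_deriv[OF d1[OF that]])
  have e0': "?e \<mu>0 = of_real z0" using e_eq[of \<mu>0] e0 by simp
  show "deriv (\<lambda>\<mu>. p (exp (\<beta> * \<mu>))) \<mu>0 = \<beta> * (z0 * Re (deriv P z0))"
    unfolding deriv_g[OF W(2)] g_def e0' by simp
  have "((\<lambda>w. of_real \<beta> * exp (of_real \<beta> * w) * deriv P (exp (of_real \<beta> * w))) has_field_derivative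
      (of_real \<beta>)\<^sup>2 * (?e \<mu>0 * deriv P (?e \<mu>0) + (?e \<mu>0)\<^sup>2 * (deriv ^^ 2) P (?e \<mu>0)))
      (at (complex_of_real \<mu>0))"
  proof -
    have "((\<lambda>w. deriv P (exp (of_real \<beta> * w))) has_field_derivative
        (deriv ^^ 2) P (?e \<mu>0) * (?e \<mu>0 * of_real \<beta>)) (at (complex_of_real \<mu>0))"
      by (rule DERIV_chain2[where f = "deriv P" and g = "\<lambda>w. exp (of_real \<beta> * w)", OF dP'[OF WB[OF W(2)]]]) (auto intro!: derivative_eq_intros)
    then show ?thesis
      by (auto intro!: derivative_eq_intros simp: algebra_simps power2_eq_square)
  qed
  from has_real_derivative_Re_of_real[OF this]
  have "(g has_real_derivative
      Re ((of_real \<beta>)\<^sup>2 * (?e \<mu>0 * deriv P (?e \<mu>0) + (?e \<mu>0)\<^sup>2 * (deriv ^^ 2) P (?e \<mu>0)))) (at \<mu>0)"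
    unfolding g_def .
  then have "(deriv (\<lambda>\<mu>. p (exp (\<beta> * \<mu>))) has_real_derivative
      Re ((of_real \<beta>)\<^sup>2 * (?e \<mu>0 * deriv P (?e \<mu>0) + (?e \<mu>0)\<^sup>2 * (deriv ^^ 2) P (?e \<mu>0)))) (at \<mu>0)"
    by (rule has_field_derivative_transform_within_open[OF _ W]) (simp add: deriv_g)
  then have "(deriv ^^ 2) (\<lambda>\<mu>. p (exp (\<beta> * \<mu>))) \<mu>0 =
      Re ((of_real \<beta>)\<^sup>2 * (of_real z0 * deriv P (of_real z0) + (of_real z0)\<^sup>2 * (deriv ^^ 2) P (of_real z0)))"
    by (simp add: numeral_2_eq_2 DERIV_imp_deriv e0')
  then show "(deriv ^^ 2) (\<lambda>\<mu>. p (exp (\<beta> * \<mu>))) \<mu>0 =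
      \<beta>\<^sup>2 * (z0 * Re (deriv P z0) + z0\<^sup>2 * Re ((deriv ^^ 2) P z0))"
    by (simp flip: of_real_power)
qed

text \<open>The limit is found on the full disc, with uniform convergence on every smaller
  concentric one. \<open>finite_partition\<close> is part of the conclusion so that the cumulant
  formulas are available for the same L.\<close>

lemma pressure_branch_limit:
  fixes \<phi> :: "real ^ 'd::finite \<Rightarrow> ereal"
  assumes adm: "admissible \<beta> \<phi> \<B>" "b \<in> \<B>"
    and lim: "\<And>x. x > 0 \<Longrightarrow> ((\<lambda>L. pressure \<beta> \<phi> L b x) \<longlongrightarrow> ereal (p x)) at_top"
    and z0: "z0 > 0" and \<delta>: "\<delta> > 0"
    and nz: "\<forall>\<^sub>F L in at_top. \<forall>z\<in>ball (of_real z0) \<delta>. partition_fun \<beta> \<phi> L b z \<noteq> 0"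
  obtains P where
    "\<forall>\<^sub>F L in at_top. finite_partition \<beta> \<phi> L b \<and>
       is_pressure_branch \<beta> \<phi> L b z0 \<delta> (pressure_branch \<beta> \<phi> L b z0 \<delta>)"
    "P holomorphic_on ball (complex_of_real z0) \<delta>"
    "\<And>x. \<lbrakk>x > 0; complex_of_real x \<in> ball (of_real z0) \<delta>\<rbrakk> \<Longrightarrow> P (of_real x) = of_real (p x)"
    "\<And>n r. r < \<delta> \<Longrightarrow> uniform_limit (ball (of_real z0) r)
       (\<lambda>L. (deriv ^^ n) (pressure_branch \<beta> \<phi> L b z0 \<delta>)) ((deriv ^^ n) P) at_top"
proof -
  let ?B = "ball (complex_of_real z0) \<delta>"
  let ?q = "\<lambda>L. pressure_branch \<beta> \<phi> L b z0 \<delta>"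
  obtain c1 c2 L1 where L1: "L1 \<ge> 1" and fp: "\<And>L. L \<ge> L1 \<Longrightarrow> finite_partition \<beta> \<phi> L b"
    and le: "\<And>L r. \<lbrakk>L \<ge> L1; r \<ge> 0\<rbrakk> \<Longrightarrow> pressure \<beta> \<phi> L b r \<le> ereal (c1 * r + c2)"
    by (rule admissible_imp_finite_partition[OF adm]) blast
  obtain L2 where L2: "\<And>L z. \<lbrakk>L \<ge> L2; z \<in> ?B\<rbrakk> \<Longrightarrow> partition_fun \<beta> \<phi> L b z \<noteq> 0"
    using nz unfolding eventually_at_top_linorder by blast
  define L0 where "L0 = max L1 L2"
  have fp0: "finite_partition \<beta> \<phi> L b" if "L \<ge> L0" for L
    using that by (simp add: L0_def fp)
  have br: "is_pressure_branch \<beta> \<phi> L b z0 \<delta> (?q L)" if L: "L \<ge> L0" for L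
  proof -
    have "\<exists>q. is_pressure_branch \<beta> \<phi> L b z0 \<delta> q"
      by (rule finite_partition.branch_exists[OF fp0[OF L] L2 z0 \<delta>])
        (use L in \<open>simp_all add: L0_def\<close>)
    then show ?thesis unfolding pressure_branch_def by (rule someI_ex)
  qed
  have hol: "?q L holomorphic_on ?B" if "L \<ge> L0" for L
    using br[OF that] by (simp add: is_pressure_branch_def)
  have q_real: "?q L (of_real x) = of_real (real_of_ereal (pressure \<beta> \<phi> L b x))"
    if "L \<ge> L0" "x > 0" "complex_of_real x \<in> ?B" for L x
    using finite_partition.branch_of_real[OF fp0[OF that(1)] br[OF that(1)] z0 \<delta> that(2,3)]
      finite_partition.pressure_eq[OF fp0[OF that(1)], of x] that by simp
  \<comment> \<open>Bounds c1 |z| + c2 on the disc, where |z| is at most z0 + \<delta>; absolute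
    values allow for negative constants, and the 1 gives the strict inequality that
    \<open>Borel_Caratheodory_bound\<close> requires.\<close>
  define M where "M = \<bar>c1\<bar> * (z0 + \<delta>) + \<bar>c2\<bar> + 1"
  have Re_less: "Re (?q L z) < M" if L: "L \<ge> L0" and z: "z \<in> ?B" for L z
  proof -
    interpret finite_partition \<beta> \<phi> L b by (rule fp0[OF L])
    have "cmod z \<le> z0 + \<delta>"
      using z z0 norm_triangle_ineq2[of z "of_real z0"] by (simp add: dist_norm norm_minus_commute)
    have "Re (?q L z) \<le> c1 * cmod z + c2"
      using branch_Re_le[OF br[OF L] z] le[of L "cmod z"] L pressure_eq[of "cmod z"]
      by (simp add: L0_def)
    also have "\<dots> \<le> \<bar>c1\<bar> * cmod z + \<bar>c2\<bar>" by (intro add_mono mult_right_mono) auto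
    also have "\<dots> \<le> \<bar>c1\<bar> * (z0 + \<delta>) + \<bar>c2\<bar>"
      using \<open>cmod z \<le> z0 + \<delta>\<close> by (intro add_mono mult_left_mono) auto
    finally show ?thesis by (simp add: M_def)
  qed
  have z0B: "complex_of_real z0 \<in> ?B" using \<delta> by simp
  \<comment> \<open>Borel-Caratheodory controls only differences from the centre. There q_L is real
    and non-negative, so the upper bound on its real part bounds its modulus too.\<close>
  have q0: "cmod (?q L z0) \<le> M" "Re (?q L z0) \<ge> 0" if L: "L \<ge> L0" for L
  proof -
    interpret finite_partition \<beta> \<phi> L b by (rule fp0[OF L])
    have eq: "?q L z0 = of_real (ln (Xi z0) / cube_volume TYPE('d) L)"
      by (rule branch_of_real[OF br[OF L] z0 \<delta> z0 z0B])
    have nn: "ln (Xi z0) / cube_volume TYPE('d) L \<ge> 0" using Xi_ge_1[of z0] z0 V_pos by simp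
    then show "Re (?q L z0) \<ge> 0" unfolding eq by simp
    have "cmod (?q L z0) = Re (?q L z0)" unfolding eq norm_of_real Re_complex_of_real using nn by (rule abs_of_nonneg)
    with Re_less[OF L z0B] show "cmod (?q L z0) \<le> M" by simp
  qed
  have bdd: "\<exists>C. \<forall>L\<ge>L0. \<forall>z\<in>K. cmod (?q L z) \<le> C" if K: "compact K" "K \<subseteq> ?B" for K
  proof (cases "K = {}")
    case False
    \<comment> \<open>The point of K farthest from z0 gives one radius r < \<delta>, hence one
      constant for all of K.\<close>
    obtain m where m: "m \<in> K" "\<And>z. z \<in> K \<Longrightarrow> dist (of_real z0) z \<le> dist (of_real z0) m"
      using continuous_attains_sup[OF K(1) False continuous_on_dist[OF continuous_on_const continuous_on_id]]
      by blast
    define r where "r = dist (complex_of_real z0) m"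
    have r: "r < \<delta>" "r \<ge> 0" using m K by (auto simp: r_def)
    have "cmod (?q L z) \<le> 2 * r * M / (\<delta> - r) + M" if L: "L \<ge> L0" and z: "z \<in> K" for L z
    proof -
      have "cmod (?q L z - ?q L z0) \<le> 2 * r * (M - Re (?q L z0)) / (\<delta> - r)"
        by (rule Borel_Caratheodory_bound[OF hol[OF L] Re_less[OF L] r(1)])
          (use m(2)[OF z] in \<open>simp_all add: r_def\<close>)
      also have "\<dots> \<le> 2 * r * M / (\<delta> - r)"
        using q0(2)[OF L] r by (intro divide_right_mono mult_left_mono) auto
      finally show ?thesis
        using q0(1)[OF L] norm_triangle_ineq2[of "?q L z" "?q L z0"] by linarith
    qed
    then show ?thesis by blast
  qed simp
  have qlim: "((\<lambda>L. ?q L (of_real x)) \<longlongrightarrow> of_real (p x)) at_top"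
    if x: "x > 0" "complex_of_real x \<in> ?B" for x
  proof -
    have "((\<lambda>L. complex_of_real (real_of_ereal (pressure \<beta> \<phi> L b x))) \<longlongrightarrow> of_real (p x)) at_top"
      using lim_real_of_ereal[OF lim[OF x(1)]] by (rule tendsto_of_real)
    moreover have "\<forall>\<^sub>F L in at_top. complex_of_real (real_of_ereal (pressure \<beta> \<phi> L b x)) = ?q L (of_real x)"
      using eventually_ge_at_top[of L0] by eventually_elim (rule q_real[OF _ x, symmetric])
    ultimately show ?thesis by (rule Lim_transform_eventually)
  qed
  define U where "U = complex_of_real ` {x. x > 0 \<and> complex_of_real x \<in> ?B}"
  have "complex_of_real z0 islimpt U"
    unfolding islimpt_approachable
  proof (intro allI impI)
    fix e :: real assume e: "e > 0"
    \<comment> \<open>Approaching z0 from the right keeps the points positive whatever the size of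
      \<delta>.\<close>
    define t where "t = min e \<delta> / 2"
    have t: "t > 0" "t < e" "t < \<delta>" using e \<delta> by (auto simp: t_def)
    have dist: "dist (complex_of_real (z0 + t)) (of_real z0) = t"
      using t by (simp add: dist_norm)
    show "\<exists>x'\<in>U. x' \<noteq> complex_of_real z0 \<and> dist x' (of_real z0) < e"
    proof (intro bexI[of _ "complex_of_real (z0 + t)"] conjI)
      show "complex_of_real (z0 + t) \<in> U"
        unfolding U_def using t z0 by (intro imageI) (simp add: dist_of_real dist_real_def del: of_real_add)
    qed (use t dist in auto)
  qed
  obtain P where P: "P holomorphic_on ?B"
    "\<And>K. \<lbrakk>compact K; K \<subseteq> ?B\<rbrakk> \<Longrightarrow> uniform_limit K ?q P at_top"
  proof (rule Vitali_convergence[of ?B L0 ?q U "complex_of_real z0" "\<lambda>z. of_real (p (Re z))"])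
    show "((\<lambda>L. ?q L z) \<longlongrightarrow> of_real (p (Re z))) at_top" if "z \<in> U" for z
      using that qlim by (auto simp: U_def)
    show "U \<subseteq> ?B" by (auto simp: U_def)
  qed (use hol bdd \<open>complex_of_real z0 islimpt U\<close> \<delta> in auto)
  show thesis
  proof (rule that[OF _ P(1)])
    show "\<forall>\<^sub>F L in at_top. finite_partition \<beta> \<phi> L b \<and> is_pressure_branch \<beta> \<phi> L b z0 \<delta> (?q L)"
      using eventually_ge_at_top[of L0] by eventually_elim (simp add: fp0 br)
    show "P (of_real x) = of_real (p x)" if x: "x > 0" "complex_of_real x \<in> ?B" for x
    proof (rule tendsto_unique[OF _ _ qlim[OF x]])
      show "((\<lambda>L. ?q L (of_real x)) \<longlongrightarrow> P (of_real x)) at_top"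
        by (rule tendsto_uniform_limitI[OF P(2)[of "{of_real x}"]]) (use x in auto)
    qed simp
    show "uniform_limit (ball (of_real z0) r) (\<lambda>L. (deriv ^^ n) (?q L)) ((deriv ^^ n) P) at_top"
      if "r < \<delta>" for n r
    \<comment> \<open>The midpoint of r and \<delta> gives a compact disc inside the open one, with
      room left for Cauchy's estimate.\<close>
    proof (rule uniform_limit_higher_deriv[where R = \<delta> and s = "(r + \<delta>) / 2"])
      show "\<forall>\<^sub>F L in at_top. ?q L holomorphic_on ?B"
        using eventually_ge_at_top[of L0] by eventually_elim (rule hol)
      show "uniform_limit (cball (of_real z0) ((r + \<delta>) / 2)) ?q P at_top"
        by (rule P(2)) (use that in \<open>auto simp: subset_eq\<close>)
    qed (use P that in auto)
  qed
qed

theorem mainTheorem2: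
  fixes \<beta> :: real
    and \<phi> :: "real ^ 'd::finite \<Rightarrow> ereal"
    and \<B> :: "'d boundary set"
    and p :: "real \<Rightarrow> real"
    and z0 \<delta> \<mu>0 :: real
    and b :: "'d boundary"
  assumes "\<beta> > 0"
    and "pair_potential \<phi>" "stable_potential \<phi>" "tempered \<phi>" "lower_regular \<phi>"
    and "\<forall>b'\<in>\<B>. boundary_condition b'"
    and "admissible \<beta> \<phi> \<B>"
    and "\<forall>x>0. \<forall>b'\<in>\<B>. ((\<lambda>L. pressure \<beta> \<phi> L b' x) \<longlongrightarrow> ereal (p x)) at_top"
    and "z0 > 0" "b \<in> \<B>" "\<delta> > 0"
    and "\<forall>\<^sub>F L in at_top. \<forall>z\<in>ball (of_real z0) \<delta>. partition_fun \<beta> \<phi> L b z \<noteq> 0"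
    and "\<mu>0 = ln z0 / \<beta>"
  shows
    "(\<forall>\<^sub>F L in at_top. is_pressure_branch \<beta> \<phi> L b z0 \<delta> (pressure_branch \<beta> \<phi> L b z0 \<delta>)) \<and>
     (\<exists>P :: complex \<Rightarrow> complex.
        P holomorphic_on ball (of_real z0) (\<delta> / 2) \<and>
        (\<forall>x>0. complex_of_real x \<in> ball (of_real z0) (\<delta> / 2) \<longrightarrow> P (of_real x) = of_real (p x)) \<and>
        (\<forall>n\<ge>1. uniform_limit (ball (of_real z0) (\<delta> / 2))
                  (\<lambda>L. (deriv ^^ n) (pressure_branch \<beta> \<phi> L b z0 \<delta>)) ((deriv ^^ n) P) at_top)) \<and>
     ((\<lambda>L. number_mean \<beta> \<phi> L b (exp (\<beta> * \<mu>0)) / cube_volume TYPE('d) L)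
        \<longlongrightarrow> 1 / \<beta> * deriv (\<lambda>\<mu>. p (exp (\<beta> * \<mu>))) \<mu>0) at_top \<and>
     ((\<lambda>L. number_variance \<beta> \<phi> L b (exp (\<beta> * \<mu>0)) / cube_volume TYPE('d) L)
        \<longlongrightarrow> 1 / \<beta>\<^sup>2 * (deriv ^^ 2) (\<lambda>\<mu>. p (exp (\<beta> * \<mu>))) \<mu>0) at_top"
proof -
  let ?q = "\<lambda>L. pressure_branch \<beta> \<phi> L b z0 \<delta>"
  let ?V = "\<lambda>L. cube_volume TYPE('d) L"
  have lim: "((\<lambda>L. pressure \<beta> \<phi> L b x) \<longlongrightarrow> ereal (p x)) at_top" if "x > 0" for x
    using assms(8,10) that by blast
  obtain P where
    br: "\<forall>\<^sub>F L in at_top. finite_partition \<beta> \<phi> L b \<and> is_pressure_branch \<beta> \<phi> L b z0 \<delta> (?q L)"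
    and P: "P holomorphic_on ball (complex_of_real z0) \<delta>"
      "\<And>x. \<lbrakk>x > 0; complex_of_real x \<in> ball (of_real z0) \<delta>\<rbrakk> \<Longrightarrow> P (of_real x) = of_real (p x)"
    and ulim: "\<And>n r. r < \<delta> \<Longrightarrow>
       uniform_limit (ball (of_real z0) r) (\<lambda>L. (deriv ^^ n) (?q L)) ((deriv ^^ n) P) at_top"
    by (rule pressure_branch_limit[OF assms(7,10) lim assms(9,11,12)]) blast+
  have half: "ball (complex_of_real z0) (\<delta> / 2) \<subseteq> ball (of_real z0) \<delta>"
    using \<open>\<delta> > 0\<close> by (intro subset_ball) simp
  \<comment> \<open>The moments involve derivatives only at the centre, so uniform convergence is
    used there pointwise.\<close>
  have dlim: "((\<lambda>L. Re ((deriv ^^ n) (?q L) z0)) \<longlongrightarrow> Re ((deriv ^^ n) P z0)) at_top" for n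
    by (intro tendsto_Re tendsto_uniform_limitI[OF ulim[of "\<delta> / 2"]]) (use \<open>\<delta> > 0\<close> in auto)
  have dlim1: "((\<lambda>L. Re (deriv (?q L) z0)) \<longlongrightarrow> Re (deriv P z0)) at_top"
    using dlim[of 1] by simp
  have e0: "exp (\<beta> * \<mu>0) = z0" using assms(1,9,13) by simp
  have "((\<lambda>L. z0 * Re (deriv (?q L) z0)) \<longlongrightarrow> z0 * Re (deriv P z0)) at_top"
    by (intro tendsto_intros dlim1)
  moreover have "\<forall>\<^sub>F L in at_top. z0 * Re (deriv (?q L) z0) = number_mean \<beta> \<phi> L b z0 / ?V L"
    using br
  proof eventually_elim
    case (elim L)
    then interpret finite_partition \<beta> \<phi> L b by simp
    show ?case using branch_cumulants(1)[of z0 \<delta> "?q L"] elim assms(9,11) V_pos by simp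
  qed
  ultimately have mean: "((\<lambda>L. number_mean \<beta> \<phi> L b z0 / ?V L) \<longlongrightarrow> z0 * Re (deriv P z0)) at_top"
    by (rule Lim_transform_eventually)
  have "((\<lambda>L. z0 * Re (deriv (?q L) z0) + z0\<^sup>2 * Re ((deriv ^^ 2) (?q L) z0))
      \<longlongrightarrow> z0 * Re (deriv P z0) + z0\<^sup>2 * Re ((deriv ^^ 2) P z0)) at_top"
    by (intro tendsto_intros dlim1 dlim)
  moreover have "\<forall>\<^sub>F L in at_top. z0 * Re (deriv (?q L) z0) + z0\<^sup>2 * Re ((deriv ^^ 2) (?q L) z0)
      = number_variance \<beta> \<phi> L b z0 / ?V L"
    using br
  proof eventually_elim
    case (elim L)
    then interpret finite_partition \<beta> \<phi> L b by simp
    show ?case using branch_cumulants(2)[of z0 \<delta> "?q L"] elim assms(9,11) V_pos by simp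
  qed
  ultimately have var: "((\<lambda>L. number_variance \<beta> \<phi> L b z0 / ?V L)
      \<longlongrightarrow> z0 * Re (deriv P z0) + z0\<^sup>2 * Re ((deriv ^^ 2) P z0)) at_top"
    by (rule Lim_transform_eventually)
  have "\<exists>P. P holomorphic_on ball (of_real z0) (\<delta> / 2) \<and>
        (\<forall>x>0. complex_of_real x \<in> ball (of_real z0) (\<delta> / 2) \<longrightarrow> P (of_real x) = of_real (p x)) \<and>
        (\<forall>n\<ge>1. uniform_limit (ball (of_real z0) (\<delta> / 2))
                  (\<lambda>L. (deriv ^^ n) (?q L)) ((deriv ^^ n) P) at_top)"
    using P(2) half \<open>\<delta> > 0\<close>
    by (intro exI[of _ P] conjI allI impI holomorphic_on_subset[OF P(1) half] ulim) auto
  moreover have "\<forall>\<^sub>F L in at_top. is_pressure_branch \<beta> \<phi> L b z0 \<delta> (?q L)"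
    using br by eventually_elim simp
  \<comment> \<open>The powers of \<beta> from the chain rule cancel the prefactors, leaving exactly
    the limits \<open>mean\<close> and \<open>var\<close>.\<close>
  moreover have "deriv (\<lambda>\<mu>. p (exp (\<beta> * \<mu>))) \<mu>0 = \<beta> * (z0 * Re (deriv P z0))"
    by (rule pressure_derivatives_mu(1)[OF P(1) assms(11,9) P(2) assms(1,13)])
  then have "1 / \<beta> * deriv (\<lambda>\<mu>. p (exp (\<beta> * \<mu>))) \<mu>0 = z0 * Re (deriv P z0)"
    using \<open>\<beta> > 0\<close> by simp
  moreover have "(deriv ^^ 2) (\<lambda>\<mu>. p (exp (\<beta> * \<mu>))) \<mu>0 =
      \<beta>\<^sup>2 * (z0 * Re (deriv P z0) + z0\<^sup>2 * Re ((deriv ^^ 2) P z0))"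
    by (rule pressure_derivatives_mu(2)[OF P(1) assms(11,9) P(2) assms(1,13)])
  then have "1 / \<beta>\<^sup>2 * (deriv ^^ 2) (\<lambda>\<mu>. p (exp (\<beta> * \<mu>))) \<mu>0 =
      z0 * Re (deriv P z0) + z0\<^sup>2 * Re ((deriv ^^ 2) P z0)"
    using \<open>\<beta> > 0\<close> by simp
  ultimately show ?thesis
    using mean var unfolding e0 by presburger
qed

end
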